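(* Let $G$ be a finite group and let $1\neq g\in G$. Let $\epsilon\in\{1,2\}$ be such that $\epsilon=1$ if and only if the abelianization $G^{\mathrm{ab}}=G/[G,G]$ has odd order. If $2^{\epsilon}$ divides $|N_G(\langle g\rangle)|$, then $\delta(g)$ is even.
   Context: The generating graph $\Gamma(G)$ of a finite group $G$ is the simple graph whose vertices are the nontrivial elements of $G$, two vertices $x,y$ being adjacent if and only if $x\neq y$ and $\langle x,y\rangle=G$. For $1\neq g\in G$, $\delta(g)$ denotes the degree of the vertex $g$ in $\Gamma(G)$. *)

theory Defs
  imports "HOL-Algebra.Algebra"
begin

definition gen_graph_verts :: "('a, 'b) monoid_scheme \<Rightarrow> 'a set" where
  "gen_graph_verts G = carrier G - {\<one>\<^bsub>G\<^esub>}"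

definition gen_graph_adj :: "('a, 'b) monoid_scheme \<Rightarrow> 'a \<Rightarrow> 'a \<Rightarrow> bool" where
  "gen_graph_adj G x y \<longleftrightarrow>
     x \<in> gen_graph_verts G \<and> y \<in> gen_graph_verts G \<and> x \<noteq> y \<and> generate G {x, y} = carrier G"

definition gen_graph_degree :: "('a, 'b) monoid_scheme \<Rightarrow> 'a \<Rightarrow> nat" where
  "gen_graph_degree G x = card {y \<in> gen_graph_verts G. gen_graph_adj G x y}"

definition abelianization :: "('a, 'b) monoid_scheme \<Rightarrow> 'a set monoid" where
  "abelianization G = G Mod (derived G (carrier G))"

lemma gen_graph_adj_sym: "gen_graph_adj G x y \<longleftrightarrow> gen_graph_adj G y x"
  by (auto simp: gen_graph_adj_def insert_commute)

lemma gen_graph_adj_irrefl: "\<not> gen_graph_adj G x x"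
  by (simp add: gen_graph_adj_def)

end

theory Submission
  imports Defs
begin

text \<open>
  Let \<open>N\<close> be the normalizer of \<open>\<langle>g\<rangle>\<close> and \<open>S\<close> the set of \<open>y\<close> with \<open>\<langle>g, y\<rangle> = G\<close>. If \<open>G = \<langle>g\<rangle>\<close>, the
  degree is \<open>|G| - 2\<close>; otherwise it is \<open>|S|\<close>. An involution \<open>t\<close> of \<open>N\<close> acts on \<open>S\<close> by conjugation, so
  \<open>|S|\<close> has the parity of \<open>|C\<^sub>S(t)|\<close>. For \<open>y\<close> in \<open>C\<^sub>S(t)\<close> the subgroup \<open>\<langle>g, ty\<rangle>\<close> is normalized by \<open>t\<close> and
  generates \<open>G\<close> together with \<open>t\<close>; hence it is \<open>G\<close>, or it has index 2 and misses \<open>t\<close>. If it is always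
  \<open>G\<close>, then multiplication by \<open>t\<close> is a free involution of \<open>C\<^sub>S(t)\<close>. A subgroup \<open>K\<close> of index 2 forces
  the order of the abelianization to be even, hence \<open>4\<close> divides \<open>|N|\<close>, so \<open>N \<inter> K\<close> contains an
  involution, with which the argument is repeated: when \<open>S\<close> is nonempty, \<open>K\<close> is the only subgroup of
  index 2 containing \<open>g\<close>.
\<close>

section \<open>Parity of a set under an involutive map\<close>

text \<open>The points that \<open>f\<close> moves fall into pairs \<open>{a, f a}\<close>; the
  induction removes one such pair at a time.\<close>

lemma even_card_iff_even_card_fixpoints:
  assumes "finite A" and "\<And>x. x \<in> A \<Longrightarrow> f x \<in> A" and "\<And>x. x \<in> A \<Longrightarrow> f (f x) = x"
  shows "even (card A) \<longleftrightarrow> even (card {x \<in> A. f x = x})"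
  using assms
proof (induction "card A" arbitrary: A rule: less_induct)
  case less
  show ?case
  proof (cases "\<forall>x\<in>A. f x = x")
    case True
    then have "{x \<in> A. f x = x} = A" by auto
    then show ?thesis by simp
  next
    case False
    then obtain a where a: "a \<in> A" "f a \<noteq> a" by blast
    define B where "B = A - {a, f a}"
    have fa: "f a \<in> A" "f (f a) = a" using a less.prems by auto
    have A: "A = insert a (insert (f a) B)" and "a \<notin> insert (f a) B" "f a \<notin> B"
      using a fa by (auto simp: B_def)
    moreover have finB: "finite B" using less.prems by (simp add: B_def)
    ultimately have card: "card A = card B + 2" by simp
    have "f x \<in> B" if "x \<in> B" for x
      using that less.prems(2,3)[of x] fa by (auto simp: B_def)
    then have "even (card B) \<longleftrightarrow> even (card {x \<in> B. f x = x})"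
      using less.hyps[of B] card finB less.prems(3) by (auto simp: B_def)
    moreover have "{x \<in> B. f x = x} = {x \<in> A. f x = x}"
      using a fa by (auto simp: B_def)
    ultimately show ?thesis using card by simp
  qed
qed

context group
begin

section \<open>Involutions and conjugation in a group\<close>

text \<open>Cauchy's theorem for the prime 2. Inversion acts on \<open>H\<close>, and its fixed
  points are \<open>\<one>\<close> and the involutions; their number is even, so
  \<open>\<one>\<close> is not the only one.\<close>

lemma even_card_subgroup_obtains_involution:
  assumes "subgroup H G" "finite H" "even (card H)"
  obtains t where "t \<in> H" "t \<noteq> \<one>" "t \<otimes> t = \<one>"
proof -
  interpret H: subgroup H G by fact
  let ?F = "{x \<in> H. inv x = x}"
  have "even (card ?F)"
    using even_card_iff_even_card_fixpoints[of H "\<lambda>x. inv x"] assms by simp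
  moreover have "\<one> \<in> ?F" by simp
  ultimately have "?F \<noteq> {\<one>}" by auto
  with \<open>\<one> \<in> ?F\<close> obtain t where "t \<in> H" "inv t = t" "t \<noteq> \<one>" by blast
  moreover from this have "t \<otimes> t = \<one>" using r_inv[of t] by simp
  ultimately show ?thesis using that by blast
qed

lemma involution_cancel:
  assumes "t \<in> carrier G" "t \<otimes> t = \<one>" "x \<in> carrier G"
  shows "t \<otimes> (t \<otimes> x) = x"
  using assms by (simp flip: m_assoc)

text \<open>As \<open>t\<close> is its own inverse, this set is the preimage of \<open>K\<close>
  under conjugation by \<open>t\<close>. That it is a subgroup allows inclusions between conjugates
  to be checked on generators.\<close>

lemma subgroup_conj_preimage:
  assumes "subgroup K G" "t \<in> carrier G" "t \<otimes> t = \<one>"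
  shows "subgroup {x \<in> carrier G. t \<otimes> x \<otimes> t \<in> K} G"
proof -
  interpret K: subgroup K G by fact
  have inv_t: "inv t = t" using assms by (simp add: inv_equality)
  show ?thesis
  proof
    fix x y
    assume "x \<in> {x \<in> carrier G. t \<otimes> x \<otimes> t \<in> K}" "y \<in> {x \<in> carrier G. t \<otimes> x \<otimes> t \<in> K}"
    then have xy: "x \<in> carrier G" "y \<in> carrier G" "t \<otimes> x \<otimes> t \<in> K" "t \<otimes> y \<otimes> t \<in> K" by auto
    have "(t \<otimes> x \<otimes> t) \<otimes> (t \<otimes> y \<otimes> t) = t \<otimes> (x \<otimes> y) \<otimes> t"
      using xy(1,2) assms by (simp add: m_assoc involution_cancel)
    then show "x \<otimes> y \<in> {x \<in> carrier G. t \<otimes> x \<otimes> t \<in> K}"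
      using xy K.m_closed[OF xy(3,4)] by simp
  next
    fix x
    assume "x \<in> {x \<in> carrier G. t \<otimes> x \<otimes> t \<in> K}"
    then have x: "x \<in> carrier G" "t \<otimes> x \<otimes> t \<in> K" by auto
    have "inv (t \<otimes> x \<otimes> t) = t \<otimes> inv x \<otimes> t"
      using x(1) assms by (simp add: inv_mult_group inv_t m_assoc)
    then show "inv x \<in> {x \<in> carrier G. t \<otimes> x \<otimes> t \<in> K}"
      using x K.m_inv_closed[OF x(2)] by simp
  qed (use assms in auto)
qed

lemma generate_pair_in_subgroup:
  assumes "generate G {g, y} = carrier G" "subgroup M G" "g \<in> M" "y \<in> M"
  shows "M = carrier G"
  using generate_subgroup_incl[of "{g, y}" M] assms subgroup.subset[OF assms(2)] by auto

lemma normalizer_conj_closed: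
  assumes "x \<in> normalizer G H" "H \<subseteq> carrier G" "h \<in> H"
  shows "x \<otimes> h \<otimes> inv x \<in> H"
proof -
  have "x <# H #> inv x = H"
    using assms by (simp add: normalizer_def stabilizer_def)
  moreover have "x \<otimes> h \<otimes> inv x \<in> x <# H #> inv x"
    using assms(3) by (auto simp: l_coset_def r_coset_def)
  ultimately show ?thesis by simp
qed

section \<open>Index 2 and the abelianization\<close>

text \<open>The subgroups of index at most 2, via the homomorphism onto a group of order 2 with kernel \<open>K\<close>.\<close>

definition parity_subgroup :: "'a set \<Rightarrow> bool" where
  "parity_subgroup K \<longleftrightarrow> subgroup K G \<and>
     (\<forall>x\<in>carrier G. \<forall>y\<in>carrier G. x \<otimes> y \<in> K \<longleftrightarrow> (x \<in> K \<longleftrightarrow> y \<in> K))"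

lemma parity_subgroup_mult:
  assumes "parity_subgroup K" "x \<in> carrier G" "y \<in> carrier G"
  shows "x \<otimes> y \<in> K \<longleftrightarrow> (x \<in> K \<longleftrightarrow> y \<in> K)"
  using assms by (simp add: parity_subgroup_def)

lemma parity_subgroup_inv:
  assumes "parity_subgroup K" "x \<in> carrier G"
  shows "inv x \<in> K \<longleftrightarrow> x \<in> K"
  using assms subgroup.m_inv_closed[of K G x] subgroup.m_inv_closed[of K G "inv x"]
  by (auto simp: parity_subgroup_def)

text \<open>Two homomorphisms to a group of order 2 agree on a subgroup, here \<open>?M\<close>. It
  contains \<open>g\<close>, which is in both kernels, and \<open>y\<close>, which is in neither
  because the kernels are proper.\<close>

lemma parity_subgroup_unique:
  assumes K: "parity_subgroup K" "K \<noteq> carrier G" "g \<in> K"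
    and L: "parity_subgroup L" "L \<noteq> carrier G" "g \<in> L"
    and gen: "y \<in> carrier G" "generate G {g, y} = carrier G"
  shows "K = L"
proof -
  have subgroups: "subgroup K G" "subgroup L G" using K L by (auto simp: parity_subgroup_def)
  let ?M = "{x \<in> carrier G. x \<in> K \<longleftrightarrow> x \<in> L}"
  have "subgroup ?M G"
    using subgroups K(1) L(1)
    by (intro subgroupI) (auto simp: parity_subgroup_mult parity_subgroup_inv intro: subgroup.one_closed)
  moreover have "y \<notin> K" "y \<notin> L"
    using generate_pair_in_subgroup[OF gen(2)] subgroups K L by blast+
  moreover have "g \<in> carrier G" using subgroup.subset[OF subgroups(1)] K by blast
  ultimately have "?M = carrier G"
    using generate_pair_in_subgroup[OF gen(2), of ?M] gen(1) K(3) L(3) by simp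
  then show ?thesis
    using subgroup.subset[OF subgroups(1)] subgroup.subset[OF subgroups(2)] by blast
qed

text \<open>Left multiplication by \<open>t\<close> carries \<open>H \<inter> K\<close> onto its
  complement in \<open>H\<close>.\<close>

lemma card_parity_subgroup_Int:
  assumes "parity_subgroup K" "subgroup H G" "finite H" "t \<in> H" "t \<notin> K"
  shows "card H = 2 * card (H \<inter> K)"
proof -
  interpret H: subgroup H G by fact
  have "bij_betw (\<lambda>x. t \<otimes> x) (H \<inter> K) (H - K)"
  proof (rule bij_betwI[where g = "\<lambda>x. inv t \<otimes> x"])
    show "(\<lambda>x. t \<otimes> x) \<in> H \<inter> K \<rightarrow> H - K" "(\<lambda>x. inv t \<otimes> x) \<in> H - K \<rightarrow> H \<inter> K"
      using assms by (auto simp: parity_subgroup_mult parity_subgroup_inv)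
  qed (use assms in \<open>auto simp flip: m_assoc\<close>)
  then have "card (H - K) = card (H \<inter> K)" using bij_betw_same_card by metis
  then show ?thesis
    using card_Int_Diff[OF assms(3), of K] by simp
qed

text \<open>In a commutator every factor occurs together with its inverse, so \<open>K\<close>
  contains the derived subgroup. The order of the latter therefore divides \<open>card K\<close>,
  which is half the order of \<open>G\<close>.\<close>

lemma parity_subgroup_even_abelianization:
  assumes fin: "finite (carrier G)" and K: "parity_subgroup K" "K \<noteq> carrier G"
  shows "even (order (abelianization G))"
proof -
  let ?D = "derived G (carrier G)"
  have sub: "subgroup K G" using K by (simp add: parity_subgroup_def)
  have sD: "subgroup ?D G" by (rule derived_is_subgroup) simp
  have "?D \<subseteq> K"
    unfolding derived_def
    by (rule generate_subgroup_incl[OF _ sub])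
       (auto simp: parity_subgroup_mult[OF K(1)] parity_subgroup_inv[OF K(1)])
  then have "subgroup ?D (G\<lparr>carrier := K\<rparr>)" using subgroup_incl[OF sD sub] by simp
  then obtain m where m: "m * card ?D = card K"
    using group.lagrange[OF subgroup_imp_group[OF sub]] by (auto simp: order_def)
  obtain t where "t \<in> carrier G" "t \<notin> K" using K subgroup.subset[OF sub] by blast
  then have "order G = 2 * card K"
    using card_parity_subgroup_Int[OF K(1) subgroup_self fin] subgroup.subset[OF sub]
    by (simp add: order_def Int_absorb1)
  moreover have "order (abelianization G) * card ?D = order G"
    using lagrange[OF sD] by (simp add: abelianization_def FactGroup_def order_def)
  ultimately have "order (abelianization G) * card ?D = (2 * m) * card ?D" using m by simp
  moreover have "card ?D > 0"
    using sD fin by (metis card_gt_0_iff empty_iff finite_subset subgroup.one_closed subgroup.subset)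
  ultimately show ?thesis by simp
qed

section \<open>Elements that generate the group together with \<open>g\<close>\<close>

text \<open>Unlike the neighbourhood of \<open>g\<close> in the graph, this set may contain
  \<open>\<one>\<close> and \<open>g\<close>, but only if \<open>g\<close> alone generates the
  group.\<close>

definition gen_partners :: "'a \<Rightarrow> 'a set" where
  "gen_partners g = {y \<in> carrier G. generate G {g, y} = carrier G}"

text \<open>The conjugate of \<open>g\<close> lies in \<open>L\<close>, so the preimage of
  \<open>L\<close> under conjugation by \<open>t\<close> contains \<open>g\<close> and
  \<open>y\<close> and is the whole group. As conjugation by \<open>t\<close> is bijective, so is
  \<open>L\<close>.\<close>

lemma conj_gen_partners:
  assumes "g \<in> carrier G" "t \<in> carrier G" "t \<otimes> t = \<one>" "t \<otimes> g \<otimes> t \<in> generate G {g}"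
    and "y \<in> gen_partners g"
  shows "t \<otimes> y \<otimes> t \<in> gen_partners g"
proof -
  have y: "y \<in> carrier G" "generate G {g, y} = carrier G"
    using assms by (auto simp: gen_partners_def)
  define L where "L = generate G {g, t \<otimes> y \<otimes> t}"
  have sub: "subgroup L G" unfolding L_def using assms y by (intro generate_is_subgroup) auto
  have "generate G {g} \<subseteq> L" unfolding L_def by (rule mono_generate) auto
  then have "t \<otimes> g \<otimes> t \<in> L" using assms by auto
  moreover have "t \<otimes> y \<otimes> t \<in> L" unfolding L_def by (rule generate.incl) simp
  ultimately have pre: "{x \<in> carrier G. t \<otimes> x \<otimes> t \<in> L} = carrier G"
    using generate_pair_in_subgroup[OF y(2) subgroup_conj_preimage[OF sub]] assms y by auto
  have "x \<in> L" if "x \<in> carrier G" for x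
  proof -
    \<comment> \<open>Conjugating twice returns to \<open>x\<close>.\<close>
    have "t \<otimes> x \<otimes> t \<in> carrier G" using that assms by simp
    then have "t \<otimes> (t \<otimes> x \<otimes> t) \<otimes> t \<in> L" using pre by blast
    then show ?thesis using that assms by (simp add: m_assoc involution_cancel)
  qed
  then have "L = carrier G" using subgroup.subset[OF sub] by blast
  then show ?thesis using assms y by (simp add: gen_partners_def L_def)
qed

text \<open>Conjugation by \<open>t\<close> sends \<open>g\<close> into
  \<open>generate G {g}\<close> and fixes \<open>t \<otimes> y\<close>, so \<open>t\<close>
  normalizes \<open>K\<close>. Then the union of \<open>K\<close> and its coset by \<open>t\<close>
  is a subgroup containing \<open>g\<close> and \<open>y\<close>, hence the whole group.\<close>

lemma parity_subgroup_of_commuting: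
  assumes "g \<in> carrier G" "t \<in> carrier G" "t \<otimes> t = \<one>" "t \<otimes> g \<otimes> t \<in> generate G {g}"
    and "y \<in> gen_partners g" "t \<otimes> y = y \<otimes> t"
    and "t \<otimes> y \<notin> gen_partners g"
  defines "K \<equiv> generate G {g, t \<otimes> y}"
  shows "parity_subgroup K" "K \<noteq> carrier G" "g \<in> K" "t \<notin> K"
proof -
  have y: "y \<in> carrier G" "generate G {g, y} = carrier G"
    using assms by (auto simp: gen_partners_def)
  have sub: "subgroup K G" unfolding K_def using assms y by (intro generate_is_subgroup) auto
  interpret K: subgroup K G by fact
  show ne: "K \<noteq> carrier G" using assms y by (simp add: gen_partners_def K_def)
  show gK: "g \<in> K" unfolding K_def by (rule generate.incl) simp
  have tyK: "t \<otimes> y \<in> K" unfolding K_def by (rule generate.incl) simp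
  show tK: "t \<notin> K"
  proof
    assume "t \<in> K"
    \<comment> \<open>This product is \<open>y\<close>, so \<open>K\<close> would contain both
      \<open>g\<close> and \<open>y\<close>.\<close>
    then have "t \<otimes> (t \<otimes> y) \<in> K" using tyK by simp
    then have "y \<in> K" by (simp only: involution_cancel[OF assms(2,3) y(1)])
    then show False using generate_pair_in_subgroup[OF y(2) sub gK] ne by blast
  qed
  have "t \<otimes> (t \<otimes> y) \<otimes> t = t \<otimes> y"
    unfolding involution_cancel[OF assms(2,3) y(1)] by (rule assms(6)[symmetric])
  moreover have "generate G {g} \<subseteq> K" unfolding K_def by (rule mono_generate) auto
  ultimately have "K \<subseteq> {x \<in> carrier G. t \<otimes> x \<otimes> t \<in> K}"
    using assms y tyK subgroup_conj_preimage[OF sub]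
    by (subst K_def, intro generate_subgroup_incl) auto
  then have norm: "t \<otimes> k \<otimes> t \<in> K" if "k \<in> K" for k using that by blast
  \<comment> \<open>The condition \<open>t \<otimes> z \<in> K\<close> says that \<open>z\<close>
    lies in the coset of \<open>t\<close>. The product of an element of \<open>K\<close> and one of
    the coset is in the coset, because \<open>t\<close> normalizes \<open>K\<close>; two elements of
    the coset have their product in \<open>K\<close>.\<close>
  have tmul: "t \<otimes> (x \<otimes> z) \<in> K"
    if "x \<in> K" "z \<in> carrier G" "t \<otimes> z \<in> K" for x z
  proof -
    have "(t \<otimes> x \<otimes> t) \<otimes> (t \<otimes> z) = t \<otimes> (x \<otimes> z)"
      using that assms by (simp add: m_assoc involution_cancel)
    then show ?thesis using K.m_closed[OF norm[OF that(1)] that(3)] by simp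
  qed
  have tmul': "x \<otimes> z \<in> K"
    if "x \<in> carrier G" "z \<in> carrier G" "t \<otimes> x \<in> K" "t \<otimes> z \<in> K" for x z
    using tmul[OF that(3,2,4)] that assms by (simp add: m_assoc involution_cancel)
  have inv_t: "inv t = t" using assms by (simp add: inv_equality)
  let ?M = "{x \<in> carrier G. x \<in> K \<or> t \<otimes> x \<in> K}"
  have "subgroup ?M G"
  proof
    fix x z assume "x \<in> ?M" "z \<in> ?M"
    then have xz: "x \<in> carrier G" "z \<in> carrier G" "x \<in> K \<or> t \<otimes> x \<in> K" "z \<in> K \<or> t \<otimes> z \<in> K"
      by auto
    have "t \<otimes> (x \<otimes> z) \<in> K" if "t \<otimes> x \<in> K" "z \<in> K"
      using K.m_closed[OF that] xz(1,2) \<open>t \<in> carrier G\<close> by (simp add: m_assoc)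
    then show "x \<otimes> z \<in> ?M"
      using tmul[of x z] tmul'[of x z] xz by auto
  next
    fix x assume x: "x \<in> ?M"
    have "t \<otimes> inv x \<in> K" if "t \<otimes> x \<in> K"
    proof -
      have "inv x \<otimes> t \<in> K" using K.m_inv_closed[OF that] x assms by (simp add: inv_mult_group inv_t)
      from norm[OF this] show ?thesis using x assms by (simp add: m_assoc)
    qed
    then show "inv x \<in> ?M" using x by auto
  qed auto
  then have M: "?M = carrier G"
    using generate_pair_in_subgroup[OF y(2), of ?M] gK tyK assms y by auto
  have "x \<otimes> z \<in> K \<longleftrightarrow> (x \<in> K \<longleftrightarrow> z \<in> K)" if xz: "x \<in> carrier G" "z \<in> carrier G" for x z
  proof (cases "x \<in> K")
    case True
    have "z \<in> K" if "x \<otimes> z \<in> K"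
      using K.m_closed[OF K.m_inv_closed[OF True] that] xz by (simp flip: m_assoc)
    then show ?thesis using True by auto
  next
    case False
    have "x \<in> K" if "x \<otimes> z \<in> K" "z \<in> K"
      using K.m_closed[OF that(1) K.m_inv_closed[OF that(2)]] xz by (simp add: m_assoc)
    \<comment> \<open>Since \<open>?M\<close> is everything, elements outside \<open>K\<close> lie
      in the coset of \<open>t\<close>.\<close>
    moreover have "x \<otimes> z \<in> K" if "z \<notin> K" using tmul' xz M False that by blast
    ultimately show ?thesis using False by blast
  qed
  then show "parity_subgroup K" using sub by (simp add: parity_subgroup_def)
qed

text \<open>Two involutive maps are counted in turn: conjugation by \<open>t\<close> on
  \<open>?S\<close>, then multiplication by \<open>t\<close> on its fixed points \<open>?C\<close>.
  The second has no fixed point as \<open>t \<noteq> \<one>\<close>, so oddness forces it to leave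
  \<open>?S\<close> somewhere.\<close>

lemma odd_gen_partners_obtains_parity_subgroup:
  assumes "finite (carrier G)" "odd (card (gen_partners g))"
    and "g \<in> carrier G" "t \<in> carrier G" "t \<noteq> \<one>" "t \<otimes> t = \<one>" "t \<otimes> g \<otimes> t \<in> generate G {g}"
  obtains K where "parity_subgroup K" "K \<noteq> carrier G" "g \<in> K" "t \<notin> K"
proof -
  let ?S = "gen_partners g"
  let ?C = "{y \<in> ?S. t \<otimes> y \<otimes> t = y}"
  have fin: "finite ?S" using assms(1) by (simp add: gen_partners_def)
  have carr: "y \<in> carrier G" if "y \<in> ?S" for y using that by (simp add: gen_partners_def)
  have "even (card ?S) \<longleftrightarrow> even (card ?C)"
  proof (rule even_card_iff_even_card_fixpoints[OF fin])
    show "t \<otimes> y \<otimes> t \<in> ?S" if "y \<in> ?S" for y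
      by (rule conj_gen_partners[OF assms(3,4,6,7) that])
    show "t \<otimes> (t \<otimes> y \<otimes> t) \<otimes> t = y" if "y \<in> ?S" for y
      using carr[OF that] assms(4,6) by (simp add: m_assoc involution_cancel)
  qed
  then have odd: "odd (card ?C)" using assms by blast
  have "\<exists>y\<in>?C. t \<otimes> y \<notin> ?S"
  proof (rule ccontr)
    assume "\<not> ?thesis"
    \<comment> \<open>Multiplication by \<open>t\<close> preserves commuting with \<open>t\<close>,
      so staying in \<open>?S\<close> means staying in \<open>?C\<close>.\<close>
    then have closed: "t \<otimes> y \<in> ?C" if "y \<in> ?C" for y
      using that assms carr by (auto simp: m_assoc)
    have "even (card ?C) \<longleftrightarrow> even (card {y \<in> ?C. t \<otimes> y = y})"
    proof (rule even_card_iff_even_card_fixpoints[of _ "(\<otimes>) t"])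
      show "finite ?C" using fin by simp
      show "t \<otimes> y \<in> ?C" if "y \<in> ?C" for y by (rule closed[OF that])
      show "t \<otimes> (t \<otimes> y) = y" if "y \<in> ?C" for y
        using that carr by (intro involution_cancel[OF assms(4,6)]) blast
    qed
    moreover have "t \<otimes> y \<noteq> y" if "y \<in> ?S" for y
      using r_cancel_one[OF carr[OF that] assms(4)] assms(5) by simp
    then have "{y \<in> ?C. t \<otimes> y = y} = {}" by blast
    ultimately show False using odd by (metis card.empty even_zero)
  qed
  then obtain y where y: "y \<in> ?S" "t \<otimes> y \<otimes> t = y" "t \<otimes> y \<notin> ?S" by blast
  have "t \<otimes> y = t \<otimes> (t \<otimes> y \<otimes> t)" using y by simp
  also have "\<dots> = y \<otimes> t" using assms carr[OF y(1)] by (simp add: m_assoc involution_cancel)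
  finally have "t \<otimes> y = y \<otimes> t" .
  from parity_subgroup_of_commuting[OF assms(3,4,6,7) y(1) this y(3)] show ?thesis
    using that by blast
qed

text \<open>Were the number odd, every involution of the normalizer would be missed by some proper
  parity subgroup containing \<open>g\<close>. Only one such subgroup exists, and it contains an
  involution of the normalizer.\<close>

lemma even_card_gen_partners:
  assumes fin: "finite (carrier G)" and g: "g \<in> carrier G"
    and even: "even (card (normalizer G (generate G {g})))"
    and four: "even (order (abelianization G)) \<Longrightarrow> 4 dvd card (normalizer G (generate G {g}))"
  shows "even (card (gen_partners g))"
proof (rule ccontr)
  assume odd: "odd (card (gen_partners g))"
  define N where "N = normalizer G (generate G {g})"
  have gen: "generate G {g} \<subseteq> carrier G" using g by (intro generate_incl) auto
  have N: "subgroup N G" unfolding N_def using gen by (rule normalizer_imp_subgroup)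
  interpret N: subgroup N G by (rule N)
  have finN: "finite N" using finite_subset[OF N.subset fin] .
  have conj: "t \<otimes> g \<otimes> t \<in> generate G {g}" if "t \<in> N" "t \<otimes> t = \<one>" for t
    using normalizer_conj_closed[OF that(1)[unfolded N_def] gen, of g] that
    by (simp add: generate.incl inv_equality)
  obtain t where t: "t \<in> N" "t \<noteq> \<one>" "t \<otimes> t = \<one>"
    using even_card_subgroup_obtains_involution[OF N finN] even unfolding N_def by blast
  obtain K where K: "parity_subgroup K" "K \<noteq> carrier G" "g \<in> K" "t \<notin> K"
    using odd_gen_partners_obtains_parity_subgroup[OF fin odd g N.mem_carrier[OF t(1)] t(2,3) conj[OF t(1,3)]]
    by blast
  have "4 dvd card N"
    using four parity_subgroup_even_abelianization[OF fin K(1,2)] by (simp add: N_def)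
  \<comment> \<open>As \<open>t\<close> is in \<open>N\<close> but not in \<open>K\<close>, the
    intersection has half the order of \<open>N\<close>.\<close>
  then have "even (card (N \<inter> K))"
    using card_parity_subgroup_Int[OF K(1) N finN t(1) K(4)] by presburger
  moreover have "subgroup (N \<inter> K) G"
    using N K(1) by (intro subgroups_Inter_pair) (auto simp: parity_subgroup_def)
  ultimately obtain s where s: "s \<in> N" "s \<in> K" "s \<noteq> \<one>" "s \<otimes> s = \<one>"
    using even_card_subgroup_obtains_involution[of "N \<inter> K"] finN by blast
  obtain L where L: "parity_subgroup L" "L \<noteq> carrier G" "g \<in> L" "s \<notin> L"
    using odd_gen_partners_obtains_parity_subgroup[OF fin odd g N.mem_carrier[OF s(1)] s(3,4) conj[OF s(1,4)]]
    by blast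
  have "gen_partners g \<noteq> {}" using odd by auto
  then obtain y where "y \<in> carrier G" "generate G {g, y} = carrier G"
    by (auto simp: gen_partners_def)
  from parity_subgroup_unique[OF K(1-3) L(1-3) this] show False using s L by blast
qed

section \<open>The degree in the generating graph\<close>

lemma normalizer_carrier: "normalizer G (carrier G) = carrier G"
proof
  show "normalizer G (carrier G) \<subseteq> carrier G"
    by (rule subgroup.subset[OF normalizer_imp_subgroup[OF subset_refl]])
  have "x <# carrier G #> inv x = carrier G" if "x \<in> carrier G" for x
    using that by (metis coset_join2 coset_join3 inv_closed subgroup_self)
  then show "carrier G \<subseteq> normalizer G (carrier G)"
    by (auto simp: normalizer_def stabilizer_def)
qed

lemma even_gen_graph_degree:
  assumes fin: "finite (carrier G)" and g: "g \<in> carrier G" "g \<noteq> \<one>"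
    and even: "even (card (normalizer G (generate G {g})))"
    and four: "even (order (abelianization G)) \<Longrightarrow> 4 dvd card (normalizer G (generate G {g}))"
  shows "even (gen_graph_degree G g)"
proof -
  have "{y \<in> gen_graph_verts G. gen_graph_adj G g y} = gen_partners g - {\<one>, g}"
    using g by (auto simp: gen_graph_verts_def gen_graph_adj_def gen_partners_def)
  then have deg: "gen_graph_degree G g = card (gen_partners g - {\<one>, g})"
    by (simp add: gen_graph_degree_def)
  \<comment> \<open>Thus \<open>\<one>\<close>, like \<open>g\<close> itself, is a partner of
    \<open>g\<close> only when \<open>g\<close> generates the group.\<close>
  have gen_one: "generate G {g, \<one>} = generate G {g}"
  proof
    show "generate G {g, \<one>} \<subseteq> generate G {g}"
      using g by (intro generate_subgroup_incl generate_is_subgroup)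
        (auto intro: generate.incl generate.one)
    show "generate G {g} \<subseteq> generate G {g, \<one>}" by (intro mono_generate) auto
  qed
  show ?thesis
  proof (cases "generate G {g} = carrier G")
    case True
    then have "generate G {g, y} = carrier G" if "y \<in> carrier G" for y
      using that g mono_generate[of "{g}" "{g, y}"] generate_incl[of "{g, y}"] by blast
    then have "gen_partners g = carrier G" by (auto simp: gen_partners_def)
    then have "gen_graph_degree G g = card (carrier G) - card {\<one>, g}"
      using deg fin g by (simp add: card_Diff_subset)
    \<comment> \<open>Here the normalizer is the whole group, so its order is even, and the two
      distinct elements \<open>\<one>\<close> and \<open>g\<close> are removed.\<close>
    then show ?thesis using even True g by (simp add: normalizer_carrier)
  next
    case False
    then have "gen_partners g - {\<one>, g} = gen_partners g"
      using gen_one by (auto simp: gen_partners_def)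
    then show ?thesis using deg even_card_gen_partners[OF fin g(1) even four] by simp
  qed
qed

end

theorem proposition1:
  fixes G :: "('a, 'b) monoid_scheme" and g :: 'a and \<epsilon> :: nat
  assumes "group G"
    and "finite (carrier G)"
    and "g \<in> carrier G" and "g \<noteq> \<one>\<^bsub>G\<^esub>"
    and "\<epsilon> \<in> {1, 2}"
    and "\<epsilon> = 1 \<longleftrightarrow> odd (order (abelianization G))"
    and "2 ^ \<epsilon> dvd card (normalizer G (generate G {g}))"
  shows "even (gen_graph_degree G g)"
proof (rule group.even_gen_graph_degree[OF assms(1-4)])
  \<comment> \<open>Either value of \<open>\<epsilon>\<close> makes \<open>2 ^ \<epsilon>\<close>
    even, and an abelianization of even order forces \<open>\<epsilon> = 2\<close>.\<close>
  show "even (card (normalizer G (generate G {g})))"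
    using assms(5,7) by (auto elim: dvd_trans[rotated])
  show "4 dvd card (normalizer G (generate G {g}))" if "even (order (abelianization G))"
    using assms(5-7) that by auto
qed

end
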